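(* Let $M,A\in\mathbb{N}$ with $M\ge3$ and $1<A<M$, and let $\delta=\log A/\log M$. Then the expectation of $\beta^s(M,\mathcal{A})$ over $\mathcal{A}\in\mathbb{A}(M,A)$ with respect to $\mu$ satisfies $$\mathbb{E}(\beta^s(M,\mathcal{A}))\ge\max\left\{0,\frac12-\frac34\delta+o_M(1)\right\}.$$ Here $o_M(1)$ denotes a quantity depending only on $M$ that tends to $0$ as $M\to\infty$; that is, there is a sequence of real numbers $(\eta_M)_{M\ge3}$ with $\eta_M\to0$ as $M\to\infty$ such that, for all $M\ge3$ and all $1<A<M$, the inequality holds with $o_M(1)=\eta_M$.
   Context: $\mathbb{A}(M,A)=\{\mathcal{A}\subset\{0,\dots,M-1\}:\mathrm{Card}(\mathcal{A})=A\}$ is the space of alphabets of cardinality $A$, and $\mu$ is the uniform counting probability measure on it: $\mu(\Omega)=\mathrm{Card}(\Omega)/\binom{M}{A}$ for $\Omega\subset\mathbb{A}(M,A)$. $\mathbb{E}$ is expectation with respect to $\mu$. For an alphabet $\mathcal{A}\subset\{0,\dots,M-1\}$ and $k\in\mathbb{N}=\{1,2,\dots\}$, the discrete Cantor set is $$\mathcal{C}_k=\mathcal{C}_k(M,\mathcal{A})=\Big\{\sum_{j=0}^{k-1}a_jM^j: a_0,\dots,a_{k-1}\in\mathcal{A}\Big\}\subset\{0,\dots,M^k-1\}.$$ For $N\in\mathbb{N}$, $l^2_N$ is the Hilbert space of functions $u:\{0,\dots,N-1\}\to\mathbb{C}$ with $\|u\|_{l^2_N}^2=\sum_{j=0}^{N-1}|u(j)|^2$,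 and $\mathcal{F}_N:l^2_N\to l^2_N$ is the unitary discrete Fourier transform $$\mathcal{F}_Nu(j)=\frac{1}{\sqrt N}\sum_{l=0}^{N-1}e^{-\frac{2\pi i jl}{N}}u(l).$$ With $N=M^k$, set $r_k=\|1_{\mathcal{C}_k}\mathcal{F}_N1_{\mathcal{C}_k}\|_{l^2_N\to l^2_N}$ (operator norm), where $1_{\mathcal{C}_k}$ denotes multiplication by the indicator function of $\mathcal{C}_k$. The sharp exponent in the fractal uncertainty principle is $$\beta^s(M,\mathcal{A})=\sup\{\beta\ge0: r_k\le N^{-\beta}\text{ with } N=M^k,\text{ for all }k\in\mathbb{N}\}.$$ *)

theory Defs
  imports "HOL-Analysis.Analysis"
begin

definition alphabets :: "nat \<Rightarrow> nat \<Rightarrow> nat set set" where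
  "alphabets M A = {\<A>. \<A> \<subseteq> {0..<M} \<and> card \<A> = A}"

lemma measure_uniform_alphabets:
  assumes "A \<le> M" and "\<Omega> \<subseteq> alphabets M A"
  shows "measure (uniform_count_measure (alphabets M A)) \<Omega> = real (card \<Omega>) / real (M choose A)"
proof -
  have "finite (alphabets M A)"
    by (rule finite_subset[of _ "Pow {0..<M}"]) (auto simp: alphabets_def)
  moreover have "card (alphabets M A) = M choose A"
    using n_subsets[of "{0..<M}" A] by (simp add: alphabets_def)
  ultimately show ?thesis
    using assms(2) by (simp add: measure_uniform_count_measure)
qed

definition discrete_cantor :: "nat \<Rightarrow> nat set \<Rightarrow> nat \<Rightarrow> nat set" where
  "discrete_cantor M \<A> k = {\<Sum>j<k. a j * M ^ j | a. \<forall>j<k. a j \<in> \<A>}"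

text \<open>Since \<open>N = M ^ k\<close> varies inside a single statement, an element of $l^2_N$ is represented by a
  function on all of \<^typ>\<open>nat\<close>. Only its values on \<open>{..<N}\<close> matter: the norm and the Fourier
  transform below do not see the others.\<close>

definition l2norm :: "nat \<Rightarrow> (nat \<Rightarrow> complex) \<Rightarrow> real" where
  "l2norm N u = L2_set (\<lambda>j. cmod (u j)) {..<N}"

definition dft :: "nat \<Rightarrow> (nat \<Rightarrow> complex) \<Rightarrow> (nat \<Rightarrow> complex)" where
  "dft N u = (\<lambda>j. 1 / complex_of_real (sqrt (real N)) *
     (\<Sum>l<N. exp (- (2 * of_real pi * \<i> * of_nat j * of_nat l / of_nat N)) * u l))"

definition ind_mult :: "nat set \<Rightarrow> (nat \<Rightarrow> complex) \<Rightarrow> (nat \<Rightarrow> complex)" where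
  "ind_mult X u = (\<lambda>j. indicator X j * u j)"

text \<open>The operator norm on $l^2_N$, in the same form as \<^const>\<open>onorm\<close>. Functions \<open>u\<close> of norm \<open>0\<close>
  contribute the value \<open>0\<close>, by the convention \<open>x / 0 = 0\<close>.\<close>

definition l2_onorm :: "nat \<Rightarrow> ((nat \<Rightarrow> complex) \<Rightarrow> (nat \<Rightarrow> complex)) \<Rightarrow> real" where
  "l2_onorm N T = (SUP u. l2norm N (T u) / l2norm N u)"

definition fup_norm :: "nat \<Rightarrow> nat set \<Rightarrow> nat \<Rightarrow> real" where
  "fup_norm M \<A> k =
     l2_onorm (M ^ k)
       (ind_mult (discrete_cantor M \<A> k) \<circ> dft (M ^ k) \<circ> ind_mult (discrete_cantor M \<A> k))"

text \<open>For \<open>M \<ge> 2\<close> and nonempty \<open>\<A> \<subseteq> {0..<M}\<close> the set below contains \<open>0\<close>, because the operator is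
  a contraction, and it is bounded above by \<open>1/2\<close>, because the operator has a matrix entry of modulus
  $N^{-1/2}$. So the real supremum is the genuine one.\<close>

definition sharp_exponent :: "nat \<Rightarrow> nat set \<Rightarrow> real" where
  "sharp_exponent M \<A> =
     Sup {\<beta>. \<beta> \<ge> 0 \<and> (\<forall>k\<ge>1. fup_norm M \<A> k \<le> real (M ^ k) powr (- \<beta>))}"

end

theory Submission
  imports Defs
begin

text \<open>The proof bounds the sharp exponent by data of a single digit and then averages over alphabets.

  \<^bold>\<open>One digit suffices.\<close> The Cooley--Tukey splitting of the Fourier transform of length $M^{k+1}$ into
  transforms of lengths $M$ and $M^k$ is compatible with the digit structure of the Cantor sets, so
  $r_k \le r_1^k$ (\<open>restricted_dft_bound_mult\<close>, \<open>restricted_dft_bound_cantor\<close>). Hence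
  $\beta^s \ge -\log r_1 / \log M$, and also $\beta^s \ge 0$ because $r_1 \le 1$ by Parseval.

  \<^bold>\<open>A fourth-moment bound.\<close> The norm of the Gram matrix of $1_{\mathcal A} \mathcal{F}_M 1_{\mathcal A}$ is at
  most its Hilbert--Schmidt norm, so $r_1^4 \le S / M^2$ with
  $$S = \sum_{m, n \in \mathcal A} \Big| \sum_{j \in \mathcal A} e^{2 \pi i j (m - n) / M} \Big|^2$$
  (\<open>energy\<close>, \<open>restricted_dft_bound_energy\<close>).

  \<^bold>\<open>Averaging.\<close> The diagonal \<open>m = n\<close> contributes exactly $A^3$. For \<open>m \<noteq> n\<close> the inner sum has square-root
  cancellation on average: conditionally on \<open>m\<close> and \<open>n\<close> being letters, the others are sampled without
  replacement from a set on which the nontrivial character sums to at most \<open>2\<close> in modulus, so the mean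
  square is \<open>O(A)\<close> (\<open>sum_alphabets_pair_le\<close>). Therefore $\mathbb{E} S \le 9 A^3$ (\<open>sum_energy_le\<close>).

  By Jensen's inequality $\mathbb{E} \beta^s \ge -\log(9 A^3 / M^2) / (4 \log M)$, which is
  $\frac12 - \frac34 \delta - \log 9 / (4 \log M)$.\<close>

section \<open>Additive characters\<close>

definition e :: "real \<Rightarrow> complex" where "e x = cis (2 * pi * x)"

lemma e_add: "e (x + y) = e x * e y"
  by (simp add: e_def cis_mult distrib_left)

lemma norm_e [simp]: "cmod (e x) = 1"
  by (simp add: e_def)

lemma cnj_e: "cnj (e x) = e (- x)"
  by (simp add: e_def cis_cnj)

lemma e_minus_of_nat [simp]: "e (- real n) = 1"
  using cis_multiple_2pi[of "- real n"] by (simp add: e_def)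

lemma dft_kernel_eq_e:
  "exp (- (2 * of_real pi * \<i> * of_nat j * of_nat l / of_nat N)) = e (- (real j * real l / real N))"
  by (simp add: e_def cis_conv_exp mult_ac)

lemma e_power: "e x ^ n = e (real n * x)"
  by (induction n) (simp_all add: distrib_right e_add, simp add: e_def)

lemma sum_e_eq_0:
  assumes "m < M" "n < M" "m \<noteq> n"
  shows "(\<Sum>j<M. e (real j * (real m - real n) / real M)) = 0"
proof -
  define w where "w = e ((real m - real n) / real M)"
  have "w \<noteq> 1"
  proof
    assume "w = 1"
    then have "cos (2 * pi * ((real m - real n) / real M)) = 1"
      by (simp add: w_def e_def complex_eq_iff)
    then obtain i :: int where i: "2 * pi * ((real m - real n) / real M) = real_of_int i * 2 * pi"
      unfolding cos_one_2pi_int by blast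
    then have "real m - real n = real_of_int i * real M"
    proof -
      have "2 * pi * ((real m - real n) / real M) = 2 * pi * real_of_int i"
        using i by (simp add: mult_ac)
      then have "(real m - real n) / real M = real_of_int i"
        by (simp only: mult_cancel_left) simp
      then show ?thesis using assms by (simp add: divide_eq_eq)
    qed
    then have "int m - int n = i * int M"
      by (metis of_int_diff of_int_eq_iff of_int_mult of_int_of_nat_eq)
    moreover have "\<bar>int m - int n\<bar> < int M" using assms by linarith
    ultimately show False
      using assms(3) by (metis dvd_imp_le_int dvd_triv_right abs_of_nat eq_iff_diff_eq_0 linorder_not_le of_nat_eq_iff)
  qed
  moreover have "w ^ M = 1"
  proof -
    have "w ^ M = e (real m + - real n)"
      using assms by (simp add: w_def e_power)
    also have "\<dots> = e (real m) * e (- real n)" by (rule e_add)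
    also have "e (real m) = cnj (e (- real m))" by (simp only: cnj_e minus_minus)
    finally show ?thesis by simp
  qed
  ultimately have "(\<Sum>j<M. w ^ j) = 0"
    by (simp add: sum_gp_strict)
  then show ?thesis by (simp add: w_def e_power)
qed

section \<open>Multiplicativity along Cantor sets\<close>

text \<open>A bound on the square of the operator norm of $1_X \mathcal{F}_N 1_X$ multiplied by \<open>N\<close>: dropping the
  factor $N^{-1/2}$ from the transform makes the constants for different \<open>N\<close> multiply exactly, and
  makes \<open>N = 1\<close>, \<open>X = {0}\<close>, \<open>K = 1\<close> the starting point of the induction over Cantor sets.\<close>

definition restricted_dft_bound :: "nat \<Rightarrow> nat set \<Rightarrow> real \<Rightarrow> bool" where
  "restricted_dft_bound N X K \<longleftrightarrow> (\<forall>u. (\<Sum>j\<in>X. (cmod (\<Sum>l\<in>X. e (- (real j * real l / real N)) * u l))\<^sup>2)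
      \<le> K * (\<Sum>l\<in>X. (cmod (u l))\<^sup>2))"

text \<open>One step of the fast Fourier transform. Writing the output frequency as \<open>b P + j\<close> (\<open>b\<close> the top
  digit) and the input position as \<open>a + M l\<close> (\<open>a\<close> the bottom digit), the phase splits modulo \<open>1\<close> as
  $$\frac{(bP+j)(a+Ml)}{MP} \equiv \frac{ba}{M} + \frac{ja}{MP} + \frac{jl}{P},$$
  because the remaining term \<open>b l\<close> is an integer. So the transform of length \<open>M P\<close> is a transform of length
  \<open>P\<close> in \<open>l\<close>, a multiplication by the unimodular twiddle factor of \<open>j a / (M P)\<close>, and a transform of
  length \<open>M\<close> in \<open>a\<close>. A set which is a digit product for both ways of splitting off a digit inherits the
  product of the two bounds.\<close>

lemma restricted_dft_bound_mult:
  assumes K: "restricted_dft_bound M \<A> K" "0 \<le> K"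
    and L: "restricted_dft_bound P X L"
    and pos: "0 < M" "0 < P" and sub: "\<A> \<subseteq> {..<M}" "X \<subseteq> {..<P}"
    and Y1: "Y = (\<lambda>(b, j). b * P + j) ` (\<A> \<times> X)"
    and Y2: "Y = (\<lambda>(a, l). a + M * l) ` (\<A> \<times> X)"
  shows "restricted_dft_bound (M * P) Y (K * L)"
  unfolding restricted_dft_bound_def
proof
  fix u :: "nat \<Rightarrow> complex"
  have inj1: "inj_on (\<lambda>(b, j). b * P + j) (\<A> \<times> X)"
  proof (rule inj_on_inverseI)
    show "(\<lambda>n. (n div P, n mod P)) ((\<lambda>(b, j). b * P + j) p) = p" if "p \<in> \<A> \<times> X" for p
      using that sub pos by (auto simp: subset_iff)
  qed
  have inj2: "inj_on (\<lambda>(a, l). a + M * l) (\<A> \<times> X)"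
  proof (rule inj_on_inverseI)
    show "(\<lambda>n. (n mod M, n div M)) ((\<lambda>(a, l). a + M * l) p) = p" if "p \<in> \<A> \<times> X" for p
      using that sub pos by (auto simp: subset_iff)
  qed
  have sum1: "sum f Y = (\<Sum>b\<in>\<A>. \<Sum>j\<in>X. f (b * P + j))" for f :: "nat \<Rightarrow> real"
    unfolding Y1 sum.reindex[OF inj1] by (simp add: sum.cartesian_product case_prod_unfold)
  have sum2: "sum f Y = (\<Sum>a\<in>\<A>. \<Sum>l\<in>X. f (a + M * l))" for f :: "nat \<Rightarrow> 'b::comm_monoid_add"
    unfolding Y2 sum.reindex[OF inj2] by (simp add: sum.cartesian_product case_prod_unfold)
  \<comment> \<open>The transform of length \<open>P\<close> is \<open>v\<close>; multiplied by the twiddle factor it is \<open>w\<close>.\<close>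
  define v where "v j a = (\<Sum>l\<in>X. e (- (real j * real l / real P)) * u (a + M * l))" for j a
  define w where "w j a = e (- (real j * real a / real (M * P))) * v j a" for j a
  have kernel: "e (- (real (b * P + j) * real (a + M * l) / real (M * P))) =
      e (- (real b * real a / real M)) * (e (- (real j * real a / real (M * P))) *
        e (- (real j * real l / real P)))" for a b j l
  proof -
    have "- (real (b * P + j) * real (a + M * l) / real (M * P)) =
      - (real b * real a / real M) + (- (real j * real a / real (M * P)) +
        (- (real j * real l / real P) + - real (b * l)))"
      using pos by (simp add: field_simps)
    then show ?thesis by (simp only: e_add e_minus_of_nat mult_1_right)
  qed
  have split: "(\<Sum>n\<in>Y. e (- (real (b * P + j) * real n / real (M * P))) * u n) =
      (\<Sum>a\<in>\<A>. e (- (real b * real a / real M)) * w j a)" for b j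
    unfolding sum2 kernel w_def v_def by (simp add: sum_distrib_left mult.assoc)
  have "(\<Sum>m\<in>Y. (cmod (\<Sum>n\<in>Y. e (- (real m * real n / real (M * P))) * u n))\<^sup>2) =
      (\<Sum>j\<in>X. \<Sum>b\<in>\<A>. (cmod (\<Sum>a\<in>\<A>. e (- (real b * real a / real M)) * w j a))\<^sup>2)"
    unfolding sum1 split by (rule sum.swap)
  also have "\<dots> \<le> (\<Sum>j\<in>X. K * (\<Sum>a\<in>\<A>. (cmod (w j a))\<^sup>2))"
    using K(1) unfolding restricted_dft_bound_def by (intro sum_mono) blast
  also have "\<dots> = K * (\<Sum>a\<in>\<A>. \<Sum>j\<in>X. (cmod (v j a))\<^sup>2)"
    by (simp add: w_def norm_mult sum_distrib_left) (rule sum.swap)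
  also have "\<dots> \<le> K * (\<Sum>a\<in>\<A>. L * (\<Sum>l\<in>X. (cmod (u (a + M * l)))\<^sup>2))"
    using L K(2) unfolding restricted_dft_bound_def v_def by (intro mult_left_mono sum_mono) auto
  also have "\<dots> = K * L * (\<Sum>n\<in>Y. (cmod (u n))\<^sup>2)"
    by (simp add: sum2 flip: sum_distrib_left)
  finally show "(\<Sum>m\<in>Y. (cmod (\<Sum>n\<in>Y. e (- (real m * real n / real (M * P))) * u n))\<^sup>2)
      \<le> K * L * (\<Sum>n\<in>Y. (cmod (u n))\<^sup>2)" .
qed

lemma discrete_cantor_0 [simp]: "discrete_cantor M \<A> 0 = {0}"
  by (auto simp: discrete_cantor_def)

text \<open>The recursion peels off the top digit here and the bottom digit in the next lemma; the Fourier
  transform needs the first for its output variable and the second for its input variable.\<close>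

lemma discrete_cantor_Suc_high:
  "discrete_cantor M \<A> (Suc k) = (\<lambda>(b, j). b * M ^ k + j) ` (\<A> \<times> discrete_cantor M \<A> k)"
proof (intro equalityI subsetI)
  fix x assume "x \<in> discrete_cantor M \<A> (Suc k)"
  then obtain a where "x = (\<Sum>j<Suc k. a j * M ^ j)" "\<forall>j<Suc k. a j \<in> \<A>"
    by (auto simp: discrete_cantor_def)
  then show "x \<in> (\<lambda>(b, j). b * M ^ k + j) ` (\<A> \<times> discrete_cantor M \<A> k)"
    by (intro image_eqI[of _ _ "(a k, \<Sum>j<k. a j * M ^ j)"]) (auto simp: discrete_cantor_def)
next
  fix x assume "x \<in> (\<lambda>(b, j). b * M ^ k + j) ` (\<A> \<times> discrete_cantor M \<A> k)"
  then obtain b a where *: "b \<in> \<A>" "\<forall>j<k. a j \<in> \<A>" "x = b * M ^ k + (\<Sum>j<k. a j * M ^ j)"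
    by (auto simp: discrete_cantor_def)
  then have "x = (\<Sum>j<Suc k. (a(k := b)) j * M ^ j)" "\<forall>j<Suc k. (a(k := b)) j \<in> \<A>"
    by auto
  then show "x \<in> discrete_cantor M \<A> (Suc k)"
    unfolding discrete_cantor_def by blast
qed

lemma discrete_cantor_Suc_low:
  "discrete_cantor M \<A> (Suc k) = (\<lambda>(a, l). a + M * l) ` (\<A> \<times> discrete_cantor M \<A> k)"
proof (intro equalityI subsetI)
  fix x assume "x \<in> discrete_cantor M \<A> (Suc k)"
  then obtain a where "x = (\<Sum>j<Suc k. a j * M ^ j)" and a: "\<forall>j<Suc k. a j \<in> \<A>"
    by (auto simp: discrete_cantor_def)
  then have "x = a 0 + M * (\<Sum>j<k. a (Suc j) * M ^ j)"
    by (simp add: sum.lessThan_Suc_shift sum_distrib_left mult_ac del: sum.lessThan_Suc)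
  then show "x \<in> (\<lambda>(a, l). a + M * l) ` (\<A> \<times> discrete_cantor M \<A> k)"
    using a by (intro image_eqI[of _ _ "(a 0, \<Sum>j<k. a (Suc j) * M ^ j)"]) (auto simp: discrete_cantor_def)
next
  fix x assume "x \<in> (\<lambda>(a, l). a + M * l) ` (\<A> \<times> discrete_cantor M \<A> k)"
  then obtain b a where *: "b \<in> \<A>" "\<forall>j<k. a j \<in> \<A>" "x = b + M * (\<Sum>j<k. a j * M ^ j)"
    by (auto simp: discrete_cantor_def)
  define a' where "a' j = (case j of 0 \<Rightarrow> b | Suc i \<Rightarrow> a i)" for j
  have "x = (\<Sum>j<Suc k. a' j * M ^ j)"
    using *(3) by (simp add: a'_def sum.lessThan_Suc_shift sum_distrib_left mult_ac del: sum.lessThan_Suc)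
  moreover have "\<forall>j<Suc k. a' j \<in> \<A>"
    using * by (auto simp: a'_def split: nat.split)
  ultimately show "x \<in> discrete_cantor M \<A> (Suc k)"
    unfolding discrete_cantor_def by blast
qed

lemma discrete_cantor_subset:
  assumes "\<A> \<subseteq> {..<M}"
  shows "discrete_cantor M \<A> k \<subseteq> {..<M ^ k}"
proof (induction k)
  case (Suc k)
  have "a + M * l < M * M ^ k" if "a < M" "l < M ^ k" for a l
  proof -
    have "a + M * l < M * Suc l" using that by simp
    also have "\<dots> \<le> M * M ^ k" using that by (intro mult_le_mono2) simp
    finally show ?thesis .
  qed
  then show ?case using Suc assms by (auto simp: discrete_cantor_Suc_low subset_iff)
qed simp

lemma restricted_dft_bound_cantor:
  assumes "restricted_dft_bound M \<A> K" "0 \<le> K" "\<A> \<subseteq> {..<M}" "0 < M"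
  shows "restricted_dft_bound (M ^ k) (discrete_cantor M \<A> k) (K ^ k)"
proof (induction k)
  case 0
  then show ?case by (simp add: restricted_dft_bound_def norm_mult)
next
  case (Suc k)
  show ?case unfolding power_Suc
    using restricted_dft_bound_mult[OF assms(1,2) Suc.IH assms(4) _ assms(3)
        discrete_cantor_subset[OF assms(3)] discrete_cantor_Suc_high discrete_cantor_Suc_low] assms(4)
    by simp
qed

section \<open>Two bounds for the one-digit transform\<close>

text \<open>Both bounds for the one-digit transform below come from this expansion: summing the geometric
  kernel over all frequencies gives Parseval, and over \<open>X\<close> only gives the Hilbert--Schmidt bound.\<close>

lemma norm_restricted_dft_eq_gram:
  assumes "finite J"
  shows "complex_of_real (\<Sum>j\<in>J. (cmod (\<Sum>l\<in>X. e (- (real j * real l / real N)) * u l))\<^sup>2) =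
    (\<Sum>m\<in>X. \<Sum>n\<in>X. u n * cnj (u m) * (\<Sum>j\<in>J. e (real j * (real m - real n) / real N)))"
proof -
  have "complex_of_real (\<Sum>j\<in>J. (cmod (\<Sum>l\<in>X. e (- (real j * real l / real N)) * u l))\<^sup>2) =
     (\<Sum>j\<in>J. \<Sum>m\<in>X. \<Sum>n\<in>X. u n * cnj (u m) * (e (- (real j * real n / real N)) * e (real j * real m / real N)))"
  proof -
    have "complex_of_real ((cmod (\<Sum>l\<in>X. e (- (real j * real l / real N)) * u l))\<^sup>2) =
      (\<Sum>n\<in>X. \<Sum>m\<in>X. (e (- (real j * real n / real N)) * u n) * (cnj (u m) * e (real j * real m / real N)))" for j
      unfolding complex_norm_square cnj_sum sum_product complex_cnj_mult cnj_e by (simp add: mult_ac)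
    moreover have "(\<Sum>n\<in>X. \<Sum>m\<in>X. (e (- (real j * real n / real N)) * u n) * (cnj (u m) * e (real j * real m / real N))) =
      (\<Sum>m\<in>X. \<Sum>n\<in>X. u n * cnj (u m) * (e (- (real j * real n / real N)) * e (real j * real m / real N)))" for j
      by (subst sum.swap) (simp add: mult_ac)
    ultimately show ?thesis by (simp only: of_real_sum)
  qed
  also have "\<dots> = (\<Sum>j\<in>J. \<Sum>m\<in>X. \<Sum>n\<in>X. u n * cnj (u m) * e (real j * (real m - real n) / real N))"
    by (simp add: diff_divide_distrib right_diff_distrib flip: e_add)
  also have "\<dots> = (\<Sum>m\<in>X. \<Sum>n\<in>X. \<Sum>j\<in>J. u n * cnj (u m) * e (real j * (real m - real n) / real N))"
    by (subst sum.swap) (intro sum.cong refl sum.swap)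
  finally show ?thesis by (simp add: sum_distrib_left)
qed

text \<open>This bound says that the restricted normalized transform is a contraction. Its role is to put
  \<open>0\<close> into the set of admissible exponents, whatever the alphabet.\<close>

lemma restricted_dft_bound_Parseval:
  assumes "X \<subseteq> {..<M}"
  shows "restricted_dft_bound M X (real M)"
  unfolding restricted_dft_bound_def
proof
  fix u :: "nat \<Rightarrow> complex"
  let ?f = "\<lambda>j. (cmod (\<Sum>l\<in>X. e (- (real j * real l / real M)) * u l))\<^sup>2"
  have fin: "finite X" using assms finite_subset by blast
  have "complex_of_real (\<Sum>j<M. ?f j) =
      (\<Sum>m\<in>X. \<Sum>n\<in>X. u n * cnj (u m) * (\<Sum>j<M. e (real j * (real m - real n) / real M)))"
    by (rule norm_restricted_dft_eq_gram) simp
  also have "\<dots> = (\<Sum>m\<in>X. \<Sum>n\<in>X. if m = n then u n * cnj (u m) * of_nat M else 0)"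
    using assms by (intro sum.cong refl) (auto simp: sum_e_eq_0 subset_iff, simp add: e_def)
  also have "\<dots> = complex_of_real (real M * (\<Sum>l\<in>X. (cmod (u l))\<^sup>2))"
    using fin by (simp add: complex_norm_square sum_distrib_left mult_ac del: of_real_power)
  finally have "(\<Sum>j<M. ?f j) = real M * (\<Sum>l\<in>X. (cmod (u l))\<^sup>2)"
    by (simp only: of_real_eq_iff)
  moreover have "(\<Sum>j\<in>X. ?f j) \<le> (\<Sum>j<M. ?f j)"
    using assms by (intro sum_mono2) auto
  ultimately show "(\<Sum>j\<in>X. ?f j) \<le> real M * (\<Sum>l\<in>X. (cmod (u l))\<^sup>2)" by simp
qed

text \<open>The squared Hilbert--Schmidt norm of the Gram matrix of the unnormalized operator
  $\sqrt M\, 1_X \mathcal{F}_M 1_X$, hence the fourth power of its Schatten 4-norm.\<close>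

definition energy :: "nat \<Rightarrow> nat set \<Rightarrow> real" where
  "energy M X = (\<Sum>m\<in>X. \<Sum>n\<in>X. (cmod (\<Sum>j\<in>X. e (real j * (real m - real n) / real M)))\<^sup>2)"

text \<open>The norm of the Gram matrix is at most its Hilbert--Schmidt norm, that is, Cauchy--Schwarz on
  \<open>X \<times> X\<close> applied to the expansion of the quadratic form.\<close>

lemma restricted_dft_bound_energy:
  assumes "finite X"
  shows "restricted_dft_bound M X (sqrt (energy M X))"
  unfolding restricted_dft_bound_def
proof
  fix u :: "nat \<Rightarrow> complex"
  define g where "g m n = cmod (\<Sum>j\<in>X. e (real j * (real m - real n) / real M))" for m n
  let ?S = "\<Sum>j\<in>X. (cmod (\<Sum>l\<in>X. e (- (real j * real l / real M)) * u l))\<^sup>2"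
  have "?S = cmod (complex_of_real ?S)"
    by (simp only: norm_of_real) (simp add: sum_nonneg)
  also have "\<dots> \<le> (\<Sum>m\<in>X. \<Sum>n\<in>X. (cmod (u m) * cmod (u n)) * g m n)"
    unfolding norm_restricted_dft_eq_gram[OF assms] g_def
    by (intro order_trans[OF norm_sum] sum_mono) (simp add: norm_mult mult_ac)
  also have "\<dots> = (\<Sum>p\<in>X\<times>X. (cmod (u (fst p)) * cmod (u (snd p))) * g (fst p) (snd p))"
    by (simp add: sum.cartesian_product case_prod_unfold)
  also have "\<dots> \<le> L2_set (\<lambda>p. cmod (u (fst p)) * cmod (u (snd p))) (X\<times>X) * L2_set (\<lambda>p. g (fst p) (snd p)) (X\<times>X)"
    by (rule order_trans[OF _ L2_set_mult_ineq]) (simp add: g_def)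
  also have "L2_set (\<lambda>p. cmod (u (fst p)) * cmod (u (snd p))) (X\<times>X) = (\<Sum>l\<in>X. (cmod (u l))\<^sup>2)"
  proof -
    have "(\<Sum>p\<in>X\<times>X. (cmod (u (fst p)) * cmod (u (snd p)))\<^sup>2) = (\<Sum>l\<in>X. (cmod (u l))\<^sup>2)\<^sup>2"
      by (simp add: power_mult_distrib power2_eq_square[of "sum _ _"] sum_product
          sum.cartesian_product case_prod_unfold)
    then show ?thesis by (simp add: L2_set_def sum_nonneg)
  qed
  also have "L2_set (\<lambda>p. g (fst p) (snd p)) (X\<times>X) = sqrt (energy M X)"
    by (simp add: L2_set_def energy_def g_def sum.cartesian_product case_prod_unfold)
  finally show "?S \<le> sqrt (energy M X) * (\<Sum>l\<in>X. (cmod (u l))\<^sup>2)"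
    by (simp add: mult.commute)
qed

section \<open>The average energy of a random alphabet\<close>

lemma bij_betw_subsets_containing:
  assumes "finite X" "T \<subseteq> X"
  shows "bij_betw (\<lambda>B. B \<union> T) {B. B \<subseteq> X - T \<and> card B = b}
    {B. B \<subseteq> X \<and> card B = b + card T \<and> T \<subseteq> B}"
proof (rule bij_betw_byWitness[where f' = "\<lambda>B. B - T"])
  have "card (B \<union> T) = card B + card T" if "B \<subseteq> X - T" for B
    using that assms by (intro card_Un_disjoint) (auto intro: finite_subset)
  then show "(\<lambda>B. B \<union> T) ` {B. B \<subseteq> X - T \<and> card B = b} \<subseteq> {B. B \<subseteq> X \<and> card B = b + card T \<and> T \<subseteq> B}"
    using assms by auto
  show "(\<lambda>B. B - T) ` {B. B \<subseteq> X \<and> card B = b + card T \<and> T \<subseteq> B} \<subseteq> {B. B \<subseteq> X - T \<and> card B = b}"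
    using assms by (auto simp: card_Diff_subset finite_subset)
qed auto

lemma card_subsets_containing:
  assumes "finite X" "T \<subseteq> X"
  shows "card {B. B \<subseteq> X \<and> card B = b \<and> T \<subseteq> B} =
    (if card T \<le> b then (card X - card T) choose (b - card T) else 0)"
proof (cases "card T \<le> b")
  case True
  have "card {B. B \<subseteq> X \<and> card B = b \<and> T \<subseteq> B} = card {B. B \<subseteq> X - T \<and> card B = b - card T}"
    using bij_betw_same_card[OF bij_betw_subsets_containing[OF assms, of "b - card T"]] True by simp
  then show ?thesis
    using True assms by (simp add: n_subsets card_Diff_subset finite_subset)
next
  case False
  have "card T \<le> card B" if "B \<subseteq> X" "T \<subseteq> B" for B
    using that assms by (intro card_mono) (auto intro: finite_subset)
  then have empty: "{B. B \<subseteq> X \<and> card B = b \<and> T \<subseteq> B} = {}" using False by auto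
  show ?thesis unfolding empty using False by simp
qed

text \<open>Second moment of a sum sampled without replacement: the normalized average over \<open>B\<close> is at most that of
  independent phases, \<open>b\<close>, plus the square of the total sum over \<open>X\<close>. After expanding the square, a
  pair \<open>(m, n)\<close> is weighted by the number of \<open>B\<close> that contain both, which is one constant off the diagonal
  and another on it; so the off-diagonal terms reassemble into the square of the total sum.\<close>

lemma sum_subsets_norm_square_le:
  fixes c :: "'b \<Rightarrow> 'a::real_inner"
  assumes fin: "finite X" and c: "\<And>m. m \<in> X \<Longrightarrow> norm (c m) \<le> 1"
  shows "(\<Sum>B | B \<subseteq> X \<and> card B = b. (norm (\<Sum>m\<in>B. c m))\<^sup>2)
    \<le> real (card X choose b) * (real b + (norm (\<Sum>m\<in>X. c m))\<^sup>2)"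
proof -
  define S where "S = {B. B \<subseteq> X \<and> card B = b}"
  \<comment> \<open>The numbers of \<open>B\<close> through one given point and through two given points; both vanish where
    truncated subtraction would make the binomial coefficient misleading.\<close>
  define p1 where "p1 = (if 1 \<le> b then (card X - 1) choose (b - 1) else 0)"
  define p2 where "p2 = (if 2 \<le> b \<and> 2 \<le> card X then (card X - 2) choose (b - 2) else 0)"
  have finS: "finite S" unfolding S_def by (rule finite_subset[of _ "Pow X"]) (use fin in auto)
  have count: "(\<Sum>B\<in>S. if m \<in> B \<and> n \<in> B then 1 else 0) = real p2 + (if m = n then real p1 - real p2 else 0)"
    if "m \<in> X" "n \<in> X" for m n
  proof -
    have "(\<Sum>B\<in>S. if m \<in> B \<and> n \<in> B then 1 else 0) = real (card {B. B \<subseteq> X \<and> card B = b \<and> {m, n} \<subseteq> B})"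
      using finS by (simp add: S_def sum.If_cases Collect_conj_eq Int_assoc)
    moreover have "2 \<le> card X" if "m \<noteq> n"
      using card_mono[OF fin, of "{m, n}"] that \<open>m \<in> X\<close> \<open>n \<in> X\<close> by simp
    ultimately show ?thesis
      using card_subsets_containing[OF fin, of "{m, n}" b] that by (auto simp: p1_def p2_def numeral_2_eq_2)
  qed
  \<comment> \<open>Insert the indicators of \<open>m \<in> B\<close> and \<open>n \<in> B\<close>, so that the sum over \<open>B\<close> can be moved inside.\<close>
  have "(\<Sum>B\<in>S. (norm (\<Sum>m\<in>B. c m))\<^sup>2) =
      (\<Sum>B\<in>S. \<Sum>m\<in>X. \<Sum>n\<in>X. (if m \<in> B \<and> n \<in> B then 1 else 0) * inner (c m) (c n))"
  proof (intro sum.cong refl)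
    fix B assume "B \<in> S"
    then have B: "B \<subseteq> X" by (simp add: S_def)
    have "(\<Sum>m\<in>B. c m) = (\<Sum>m\<in>X. if m \<in> B then c m else 0)"
      using fin B by (simp add: sum.If_cases Int_absorb1 flip: Int_def)
    then have "(norm (\<Sum>m\<in>B. c m))\<^sup>2 =
        (\<Sum>m\<in>X. \<Sum>n\<in>X. inner (if m \<in> B then c m else 0) (if n \<in> B then c n else 0))"
      unfolding power2_norm_eq_inner by (simp only: inner_sum_left inner_sum_right) (rule sum.swap)
    also have "\<dots> = (\<Sum>m\<in>X. \<Sum>n\<in>X. (if m \<in> B \<and> n \<in> B then 1 else 0) * inner (c m) (c n))"
      by (intro sum.cong refl) auto
    finally show "(norm (\<Sum>m\<in>B. c m))\<^sup>2 = \<dots>" .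
  qed
  also have "\<dots> = (\<Sum>m\<in>X. \<Sum>n\<in>X. (\<Sum>B\<in>S. if m \<in> B \<and> n \<in> B then 1 else 0) * inner (c m) (c n))"
    by (subst sum.swap, intro sum.cong refl, subst sum.swap) (simp add: sum_distrib_right)
  also have "\<dots> = (\<Sum>m\<in>X. \<Sum>n\<in>X. real p2 * inner (c m) (c n) +
      (if m = n then (real p1 - real p2) * inner (c m) (c n) else 0))"
    by (intro sum.cong refl) (simp add: count distrib_right)
  also have "\<dots> = real p2 * (norm (\<Sum>m\<in>X. c m))\<^sup>2 + (real p1 - real p2) * (\<Sum>m\<in>X. (norm (c m))\<^sup>2)"
    using fin unfolding power2_norm_eq_inner inner_sum_left inner_sum_right
    by (simp add: sum.distrib sum_distrib_left) (rule sum.swap)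
  also have "\<dots> \<le> real (card X choose b) * (norm (\<Sum>m\<in>X. c m))\<^sup>2 + real p1 * real (card X)"
  proof (intro add_mono mult_right_mono)
    have "p2 \<le> card X choose b"
    proof (cases "2 \<le> b \<and> 2 \<le> card X")
      case True
      then obtain b' x' where "b = Suc (Suc b')" "card X = Suc (Suc x')"
        by (metis add_2_eq_Suc le_Suc_ex)
      then show ?thesis by (simp add: p2_def)
    qed (auto simp: p2_def)
    then show "real p2 \<le> real (card X choose b)" by simp
    have "(\<Sum>m\<in>X. (norm (c m))\<^sup>2) \<le> (\<Sum>m\<in>X. 1)"
      using c by (intro sum_mono) (simp add: power_le_one)
    then have "real p1 * (\<Sum>m\<in>X. (norm (c m))\<^sup>2) \<le> real p1 * real (card X)"
      by (intro mult_left_mono) auto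
    moreover have "(real p1 - real p2) * (\<Sum>m\<in>X. (norm (c m))\<^sup>2) \<le> real p1 * (\<Sum>m\<in>X. (norm (c m))\<^sup>2)"
      by (intro mult_right_mono sum_nonneg) auto
    ultimately show "(real p1 - real p2) * (\<Sum>m\<in>X. (norm (c m))\<^sup>2) \<le> real p1 * real (card X)"
      by linarith
  qed simp
  also have "real p1 * real (card X) = real (card X choose b) * real b"
    using times_binomial_minus1_eq[of b "card X"]
    by (cases "b = 0") (auto simp: p1_def mult.commute simp flip: of_nat_mult)
  finally show ?thesis by (simp add: S_def distrib_left add.commute)
qed

text \<open>Given two letters \<open>m \<noteq> n\<close>, the rest of the alphabet is a uniform sample of \<open>A - 2\<close> points from the
  complement of \<open>{m, n}\<close>. The character \<open>j \<mapsto> e(j (m - n) / M)\<close> sums to \<open>0\<close> over all residues, so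
  over this complement its sum has modulus at most \<open>2\<close>, and \<open>sum_subsets_norm_square_le\<close> gives a
  mean square of order \<open>A\<close> for the sample. The letters \<open>m\<close> and \<open>n\<close> themselves contribute \<open>O(1)\<close>.
  Conditioning on \<open>m, n\<close> makes the frequency deterministic.\<close>

lemma sum_alphabets_pair_le:
  assumes "m < M" "n < M" "m \<noteq> n" "2 \<le> A"
  shows "(\<Sum>\<A> | \<A> \<in> alphabets M A \<and> {m, n} \<subseteq> \<A>.
      (cmod (\<Sum>j\<in>\<A>. e (real j * (real m - real n) / real M)))\<^sup>2)
    \<le> real ((M - 2) choose (A - 2)) * (2 * real A + 12)"
proof -
  define c where "c j = e (real j * (real m - real n) / real M)" for j
  let ?T = "{m, n}" and ?X = "{0..<M} - {m, n}"
  have T: "?T \<subseteq> {0..<M}" "card ?T = 2" using assms by auto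
  have card_X: "card ?X = M - 2" using T by (simp add: card_Diff_subset)
  have T_le: "(cmod (\<Sum>j\<in>?T. c j))\<^sup>2 \<le> 4"
  proof -
    have "cmod (\<Sum>j\<in>?T. c j) \<le> 2"
      using norm_triangle_ineq[of "c m" "c n"] assms by (simp add: c_def)
    from power_mono[OF this, of 2] show ?thesis by simp
  qed
  have "(\<Sum>j<M. c j) = 0" using sum_e_eq_0[OF assms(1-3)] by (simp add: c_def)
  then have "(\<Sum>j\<in>?X. c j) = - (\<Sum>j\<in>?T. c j)"
    using T(1) by (subst sum_diff) (auto simp: lessThan_atLeast0)
  then have X_le: "(cmod (\<Sum>j\<in>?X. c j))\<^sup>2 \<le> 4" using T_le by (simp only: norm_minus_cancel)
  have bij: "bij_betw (\<lambda>B. B \<union> ?T) {B. B \<subseteq> ?X \<and> card B = A - 2} {\<A>. \<A> \<in> alphabets M A \<and> ?T \<subseteq> \<A>}"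
  proof -
    have "A - 2 + card ?T = A" using T(2) assms(4) by simp
    then show ?thesis
      using bij_betw_subsets_containing[of "{0..<M}" ?T "A - 2"] T(1)
      unfolding alphabets_def mem_Collect_eq conj_assoc by auto
  qed
  have "(\<Sum>\<A> | \<A> \<in> alphabets M A \<and> ?T \<subseteq> \<A>. (cmod (\<Sum>j\<in>\<A>. c j))\<^sup>2) =
      (\<Sum>B | B \<subseteq> ?X \<and> card B = A - 2. (cmod (\<Sum>j\<in>B \<union> ?T. c j))\<^sup>2)"
    by (rule sum.reindex_bij_betw[OF bij, symmetric])
  also have "\<dots> \<le> (\<Sum>B | B \<subseteq> ?X \<and> card B = A - 2. 2 * (cmod (\<Sum>j\<in>B. c j))\<^sup>2 + 8)"
  proof (intro sum_mono)
    fix B assume "B \<in> {B. B \<subseteq> ?X \<and> card B = A - 2}"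
    then have "finite B" "B \<inter> ?T = {}" using finite_subset[of B "?X"] by auto
    then have "cmod (\<Sum>j\<in>B \<union> ?T. c j) \<le> cmod (\<Sum>j\<in>B. c j) + cmod (\<Sum>j\<in>?T. c j)"
      using sum.union_disjoint[of B ?T c] norm_triangle_ineq by simp
    then have "(cmod (\<Sum>j\<in>B \<union> ?T. c j))\<^sup>2 \<le> (cmod (\<Sum>j\<in>B. c j) + cmod (\<Sum>j\<in>?T. c j))\<^sup>2"
      by (intro power_mono) auto
    also have "\<dots> \<le> 2 * (cmod (\<Sum>j\<in>B. c j))\<^sup>2 + 2 * (cmod (\<Sum>j\<in>?T. c j))\<^sup>2"
      using zero_le_power2[of "cmod (\<Sum>j\<in>B. c j) - cmod (\<Sum>j\<in>?T. c j)"]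
      unfolding power2_sum power2_diff by linarith
    finally show "(cmod (\<Sum>j\<in>B \<union> ?T. c j))\<^sup>2 \<le> 2 * (cmod (\<Sum>j\<in>B. c j))\<^sup>2 + 8"
      using T_le by linarith
  qed
  also have "\<dots> = 2 * (\<Sum>B | B \<subseteq> ?X \<and> card B = A - 2. (cmod (\<Sum>j\<in>B. c j))\<^sup>2) + 8 * real ((M - 2) choose (A - 2))"
    using n_subsets[of ?X "A - 2"] card_X by (simp add: sum.distrib sum_distrib_left)
  also have "\<dots> \<le> 2 * (real ((M - 2) choose (A - 2)) * (real (A - 2) + 4)) + 8 * real ((M - 2) choose (A - 2))"
  proof -
    have "(\<Sum>B | B \<subseteq> ?X \<and> card B = A - 2. (cmod (\<Sum>j\<in>B. c j))\<^sup>2)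
        \<le> real ((M - 2) choose (A - 2)) * (real (A - 2) + (cmod (\<Sum>j\<in>?X. c j))\<^sup>2)"
      using sum_subsets_norm_square_le[of ?X c "A - 2"] card_X by (simp add: c_def)
    also have "\<dots> \<le> real ((M - 2) choose (A - 2)) * (real (A - 2) + 4)"
      using X_le by (intro mult_left_mono) auto
    finally show ?thesis by linarith
  qed
  also have "\<dots> = real ((M - 2) choose (A - 2)) * (2 * real A + 12)"
    using assms(4) by (simp add: of_nat_diff algebra_simps)
  finally show ?thesis by (simp add: c_def)
qed

lemma finite_alphabets: "finite (alphabets M A)"
  by (rule finite_subset[of _ "Pow {0..<M}"]) (auto simp: alphabets_def)

lemma card_alphabets: "card (alphabets M A) = M choose A"
  using n_subsets[of "{0..<M}" A] by (simp add: alphabets_def)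

text \<open>The average energy has the order \<open>A^3\<close> of its diagonal part alone: each of the \<open>A\<close> diagonal terms is
  \<open>A^2\<close>, and each of the \<open>A (A - 1)\<close> other terms is \<open>O(A)\<close> on average by
  \<open>sum_alphabets_pair_le\<close>. The constant \<open>9\<close> is \<open>1\<close> from the diagonal plus \<open>8\<close> from
  \<open>(A - 1) (2 A + 12) \<le> 8 A^2\<close>.\<close>

lemma sum_energy_le:
  assumes "2 \<le> A" "A \<le> M"
  shows "(\<Sum>\<A>\<in>alphabets M A. energy M \<A>) \<le> 9 * real A ^ 3 * real (M choose A)"
proof -
  define f where "f \<A> m n = (cmod (\<Sum>j\<in>\<A>. e (real j * (real m - real n) / real M)))\<^sup>2" for \<A> m n
  have diag: "f \<A> m m = (real A)\<^sup>2" if "\<A> \<in> alphabets M A" for \<A> m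
    using that by (simp add: f_def alphabets_def e_def)
  have split: "energy M \<A> = real A ^ 3 +
      (\<Sum>m<M. \<Sum>n\<in>{..<M} - {m}. if {m, n} \<subseteq> \<A> then f \<A> m n else 0)" if \<A>: "\<A> \<in> alphabets M A" for \<A>
  proof -
    have sub: "\<A> \<subseteq> {..<M}" and fin: "finite \<A>" and card: "card \<A> = A"
      using \<A> finite_subset[of \<A> "{0..<M}"] by (auto simp: alphabets_def)
    have "energy M \<A> = (\<Sum>m\<in>\<A>. f \<A> m m + (\<Sum>n\<in>\<A> - {m}. f \<A> m n))"
      unfolding energy_def f_def using fin by (intro sum.cong refl sum.remove)
    also have "\<dots> = real A ^ 3 + (\<Sum>m\<in>\<A>. \<Sum>n\<in>\<A> - {m}. f \<A> m n)"
      using \<A> card by (simp add: sum.distrib diag power3_eq_cube power2_eq_square)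
    also have "(\<Sum>m\<in>\<A>. \<Sum>n\<in>\<A> - {m}. f \<A> m n) =
        (\<Sum>m<M. \<Sum>n\<in>{..<M} - {m}. if {m, n} \<subseteq> \<A> then f \<A> m n else 0)"
      using sub by (intro sum.mono_neutral_cong_left) (auto intro!: sum.mono_neutral_cong_left sum.neutral)
    finally show ?thesis .
  qed
  have "(\<Sum>\<A>\<in>alphabets M A. energy M \<A>) = real A ^ 3 * real (M choose A) +
      (\<Sum>\<A>\<in>alphabets M A. \<Sum>m<M. \<Sum>n\<in>{..<M} - {m}. if {m, n} \<subseteq> \<A> then f \<A> m n else 0)"
    by (simp add: split sum.distrib card_alphabets)
  also have "(\<Sum>\<A>\<in>alphabets M A. \<Sum>m<M. \<Sum>n\<in>{..<M} - {m}. if {m, n} \<subseteq> \<A> then f \<A> m n else 0) =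
      (\<Sum>m<M. \<Sum>n\<in>{..<M} - {m}. \<Sum>\<A>\<in>alphabets M A. if {m, n} \<subseteq> \<A> then f \<A> m n else 0)"
    by (subst sum.swap) (intro sum.cong refl sum.swap)
  also have "\<dots> = (\<Sum>m<M. \<Sum>n\<in>{..<M} - {m}. \<Sum>\<A> | \<A> \<in> alphabets M A \<and> {m, n} \<subseteq> \<A>. f \<A> m n)"
    by (simp only: sum.inter_filter[OF finite_alphabets])
  also have "\<dots> \<le> (\<Sum>m<M. \<Sum>n\<in>{..<M} - {m}. real ((M - 2) choose (A - 2)) * (2 * real A + 12))"
    using assms(1) unfolding f_def by (intro sum_mono sum_alphabets_pair_le) auto
  also have "\<dots> = real M * real (M - 1) * real ((M - 2) choose (A - 2)) * (2 * real A + 12)"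
    using assms by (simp add: card_Diff_subset of_nat_diff)
  \<comment> \<open>The number of alphabets with a marked ordered pair of distinct letters, counted in two ways.\<close>
  also have "real M * real (M - 1) * real ((M - 2) choose (A - 2)) = real A * real (A - 1) * real (M choose A)"
  proof -
    have "A * (A - 1) * (M choose A) = (A - 1) * (M * ((M - 1) choose (A - 1)))"
      using times_binomial_minus1_eq[of A M] assms by (simp add: mult_ac)
    also have "\<dots> = M * ((M - 1) * ((M - 2) choose (A - 2)))"
      using times_binomial_minus1_eq[of "A - 1" "M - 1"] assms by (simp add: mult_ac numeral_2_eq_2)
    finally show ?thesis by (metis mult.assoc of_nat_mult)
  qed
  finally have "(\<Sum>\<A>\<in>alphabets M A. energy M \<A>) \<le>
      real (M choose A) * (real A ^ 3 + real A * (real (A - 1) * (2 * real A + 12)))"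
    by (simp add: algebra_simps)
  also have "\<dots> \<le> real (M choose A) * (real A ^ 3 + real A * (8 * (real A)\<^sup>2))"
  proof -
    have "0 \<le> 6 * (real A - 1)\<^sup>2 + 2 * real A + 6" by simp
    then have "real (A - 1) * (2 * real A + 12) \<le> 8 * (real A)\<^sup>2"
      using assms by (simp add: of_nat_diff power2_eq_square algebra_simps)
    then show ?thesis by (intro mult_left_mono add_left_mono) auto
  qed
  finally show ?thesis by (simp add: power3_eq_cube power2_eq_square algebra_simps)
qed

section \<open>Bounds for the sharp exponent\<close>

lemma l2norm_restricted_dft_le:
  assumes K: "restricted_dft_bound N X K" and K0: "0 \<le> K" and X: "X \<subseteq> {..<N}"
  shows "l2norm N ((ind_mult X \<circ> dft N \<circ> ind_mult X) u) \<le> sqrt (K / real N) * l2norm N u"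
proof -
  let ?h = "\<lambda>j. \<Sum>l\<in>X. e (- (real j * real l / real N)) * u l"
  have T: "(ind_mult X \<circ> dft N \<circ> ind_mult X) u j =
      indicator X j * (1 / complex_of_real (sqrt (real N)) * ?h j)" for j
  proof -
    have "(\<Sum>l<N. e (- (real j * real l / real N)) * (indicator X l * u l)) = ?h j"
      using X by (intro sum.mono_neutral_cong_right) (auto simp: indicator_def)
    then show ?thesis by (simp add: ind_mult_def dft_def dft_kernel_eq_e)
  qed
  have "(\<Sum>j<N. (cmod ((ind_mult X \<circ> dft N \<circ> ind_mult X) u j))\<^sup>2) = (\<Sum>j\<in>X. (cmod (?h j))\<^sup>2 / real N)"
    unfolding T using X
    by (intro sum.mono_neutral_cong_right)
      (auto simp: indicator_def norm_mult norm_divide power_mult_distrib power_divide)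
  also have "\<dots> \<le> K * (\<Sum>l\<in>X. (cmod (u l))\<^sup>2) / real N"
    using K unfolding restricted_dft_bound_def by (simp add: divide_right_mono flip: sum_divide_distrib)
  finally have le: "(\<Sum>j<N. (cmod ((ind_mult X \<circ> dft N \<circ> ind_mult X) u j))\<^sup>2)
      \<le> K / real N * (\<Sum>l\<in>X. (cmod (u l))\<^sup>2)" by simp
  have "(\<Sum>l\<in>X. (cmod (u l))\<^sup>2) \<le> (\<Sum>l<N. (cmod (u l))\<^sup>2)"
    using X by (intro sum_mono2) auto
  then have "K / real N * (\<Sum>l\<in>X. (cmod (u l))\<^sup>2) \<le> K / real N * (\<Sum>l<N. (cmod (u l))\<^sup>2)"
    using K0 by (intro mult_left_mono) auto
  with le show ?thesis
    unfolding l2norm_def L2_set_def real_sqrt_mult[symmetric] by (intro real_sqrt_le_mono) linarith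
qed

lemma l2norm_restricted_dft_ratio_le:
  assumes "restricted_dft_bound N X K" "0 \<le> K" "X \<subseteq> {..<N}"
  shows "l2norm N ((ind_mult X \<circ> dft N \<circ> ind_mult X) u) / l2norm N u \<le> sqrt (K / real N)"
proof (cases "l2norm N u = 0")
  case True
  then show ?thesis using assms(2) by simp
next
  case False
  moreover have "0 \<le> l2norm N u" by (simp add: l2norm_def)
  ultimately show ?thesis
    using l2norm_restricted_dft_le[OF assms, of u] by (simp add: divide_le_eq)
qed

lemma l2_onorm_restricted_dft_le:
  assumes "restricted_dft_bound N X K" "0 \<le> K" "X \<subseteq> {..<N}"
  shows "l2_onorm N (ind_mult X \<circ> dft N \<circ> ind_mult X) \<le> sqrt (K / real N)"
  unfolding l2_onorm_def by (intro cSUP_least l2norm_restricted_dft_ratio_le[OF assms]) simp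

text \<open>A unit mass at \<open>x\<close> is mapped to a function with modulus $N^{-1/2}$ at \<open>x\<close>. The hypothesis with \<open>K\<close>
  ensures that the supremum defining the norm is taken over a bounded set.\<close>

lemma l2_onorm_restricted_dft_ge:
  assumes "restricted_dft_bound N X K" "0 \<le> K" "X \<subseteq> {..<N}" "x \<in> X"
  shows "1 / sqrt (real N) \<le> l2_onorm N (ind_mult X \<circ> dft N \<circ> ind_mult X)"
proof -
  let ?T = "ind_mult X \<circ> dft N \<circ> ind_mult X"
  define u :: "nat \<Rightarrow> complex" where "u l = (if l = x then 1 else 0)" for l
  have x: "x < N" using assms by auto
  have "(\<Sum>l<N. (cmod (u l))\<^sup>2) = (\<Sum>l<N. if l = x then 1 else 0)"
    by (intro sum.cong) (auto simp: u_def)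
  then have u1: "l2norm N u = 1" using x by (simp add: l2norm_def L2_set_def)
  have ind_u: "ind_mult X u = u" using assms(4) by (auto simp: ind_mult_def u_def)
  have mult_u: "z * u l = (if l = x then z else 0)" for z l by (simp add: u_def)
  have "?T u x = 1 / complex_of_real (sqrt (real N)) * (\<Sum>l<N. if l = x then e (- (real x * real l / real N)) else 0)"
    using assms(4) unfolding comp_def ind_u unfolding ind_mult_def dft_def dft_kernel_eq_e mult_u
    by simp
  then have "cmod (?T u x) = 1 / sqrt (real N)"
    using x by (simp add: norm_divide)
  moreover have "cmod (?T u x) \<le> l2norm N (?T u)"
    unfolding l2norm_def using x by (intro member_le_L2_set) auto
  ultimately have "1 / sqrt (real N) \<le> l2norm N (?T u) / l2norm N u" using u1 by simp
  also have "\<dots> \<le> l2_onorm N ?T"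
    unfolding l2_onorm_def using l2norm_restricted_dft_ratio_le[OF assms(1-3)]
    by (intro cSUP_upper bdd_aboveI2[where M = "sqrt (K / real N)"]) auto
  finally show ?thesis .
qed

text \<open>An estimate for the alphabet itself propagates to all levels \<open>k\<close> with the same exponent, because the
  bounds multiply along the Cantor construction. The exponents are bounded above, by \<open>1/2\<close>, thanks
  to the matrix entry of modulus $M^{-1/2}$ at level \<open>k = 1\<close>; so the supremum is an upper bound of them.\<close>

lemma sharp_exponent_ge:
  assumes K: "restricted_dft_bound M \<A> K" "0 < K" and \<A>: "\<A> \<subseteq> {..<M}" "\<A> \<noteq> {}" and M: "2 \<le> M"
    and \<beta>: "\<beta> = - ln (K / real M) / (2 * ln (real M))" "0 \<le> \<beta>"
  shows "\<beta> \<le> sharp_exponent M \<A>"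
  unfolding sharp_exponent_def
proof (rule cSup_upper)
  have bound: "restricted_dft_bound (M ^ k) (discrete_cantor M \<A> k) (K ^ k)" for k
    using restricted_dft_bound_cantor[OF K(1) _ \<A>(1)] K(2) M by simp
  note sub = discrete_cantor_subset[OF \<A>(1)]
  have lnM: "0 < ln (real M)" using M by simp
  have "fup_norm M \<A> k \<le> real (M ^ k) powr (- \<beta>)" for k
  proof -
    have "fup_norm M \<A> k \<le> sqrt (K ^ k / real (M ^ k))"
      unfolding fup_norm_def using K(2) by (intro l2_onorm_restricted_dft_le[OF bound _ sub]) simp
    also have "\<dots> = ((K / real M) ^ k) powr (1 / 2)"
      using K(2) by (simp add: powr_half_sqrt power_divide)
    also have "\<dots> = exp (real k * ln (K / real M) / 2)"
      using K(2) M by (simp add: powr_def ln_realpow)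
    also have "\<dots> = real (M ^ k) powr (- \<beta>)"
      using M lnM by (simp add: powr_def ln_realpow \<beta>(1))
    finally show ?thesis .
  qed
  then show "\<beta> \<in> {\<beta>. 0 \<le> \<beta> \<and> (\<forall>k\<ge>1. fup_norm M \<A> k \<le> real (M ^ k) powr - \<beta>)}"
    using \<beta>(2) by simp
  obtain x where "x \<in> discrete_cantor M \<A> 1"
    using \<A>(2) by (fastforce simp: discrete_cantor_Suc_low)
  then have lower: "1 / sqrt (real (M ^ 1)) \<le> fup_norm M \<A> 1"
    unfolding fup_norm_def using K(2) by (intro l2_onorm_restricted_dft_ge[OF bound _ sub]) simp_all
  show "bdd_above {\<beta>. 0 \<le> \<beta> \<and> (\<forall>k\<ge>1. fup_norm M \<A> k \<le> real (M ^ k) powr - \<beta>)}"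
  proof (rule bdd_aboveI[where M = "1 / 2"])
    fix \<gamma> assume "\<gamma> \<in> {\<beta>. 0 \<le> \<beta> \<and> (\<forall>k\<ge>1. fup_norm M \<A> k \<le> real (M ^ k) powr - \<beta>)}"
    then have "fup_norm M \<A> 1 \<le> real (M ^ 1) powr - \<gamma>" by blast
    with lower have "1 / sqrt (real M) \<le> real M powr - \<gamma>" by simp
    moreover have "1 / sqrt (real M) = real M powr - (1 / 2)"
      by (simp add: powr_minus_divide powr_half_sqrt)
    ultimately show "\<gamma> \<le> 1 / 2" using M by simp
  qed
qed

lemma sharp_exponent_nonneg:
  assumes "\<A> \<subseteq> {..<M}" "\<A> \<noteq> {}" "2 \<le> M"
  shows "0 \<le> sharp_exponent M \<A>"
  using sharp_exponent_ge[OF restricted_dft_bound_Parseval[OF assms(1)] _ assms] assms(3) by simp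

lemma energy_pos:
  assumes "finite X" "X \<noteq> {}"
  shows "0 < energy M X"
proof -
  obtain x where x: "x \<in> X" using assms(2) by blast
  show ?thesis unfolding energy_def
    by (intro sum_pos2[OF assms(1) x] sum_nonneg)
      (use assms in \<open>auto simp: card_gt_0_iff e_def intro!: sum_pos2[OF assms(1) x] sum_nonneg\<close>)
qed

text \<open>When the left-hand side is negative the energy bound yields no admissible exponent, and the
  inequality follows from nonnegativity of the sharp exponent.\<close>

lemma sharp_exponent_ge_energy:
  assumes "\<A> \<subseteq> {..<M}" "\<A> \<noteq> {}" "2 \<le> M"
  shows "- ln (energy M \<A> / (real M)\<^sup>2) / (4 * ln (real M)) \<le> sharp_exponent M \<A>"
proof -
  let ?b = "- ln (energy M \<A> / (real M)\<^sup>2) / (4 * ln (real M))"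
  have fin: "finite \<A>" using assms(1) finite_subset by blast
  have pos: "0 < energy M \<A>" by (rule energy_pos[OF fin assms(2)])
  have "?b = - ln (sqrt (energy M \<A>) / real M) / (2 * ln (real M))"
    using pos assms(3) by (simp add: ln_div ln_sqrt ln_realpow field_simps)
  then show ?thesis
    using sharp_exponent_ge[OF restricted_dft_bound_energy[OF fin] _ assms, of ?b] pos
      sharp_exponent_nonneg[OF assms] by fastforce
qed

section \<open>The expected exponent\<close>

text \<open>Jensen's inequality for the logarithm, in tangent-line form: \<open>ln x \<le> ln t + x / t - 1\<close> at
  \<open>t = 9 A^3\<close>, the bound for the average of \<open>x = energy M \<A>\<close>, so that the linear correction averages to at
  most \<open>0\<close>.\<close>

lemma expected_sharp_exponent_ge:
  assumes "3 \<le> M" "1 < A" "A < M"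
  shows "1 / 2 - 3 / 4 * (ln (real A) / ln (real M)) - ln 9 / (4 * ln (real M))
    \<le> (\<integral>\<A>. sharp_exponent M \<A> \<partial>uniform_count_measure (alphabets M A))"
proof -
  define C where "C = real (M choose A)"
  define t where "t = 9 * real A ^ 3"
  have C: "0 < C" using assms by (simp add: C_def)
  have t: "0 < t" using assms by (simp add: t_def)
  have lnM: "0 < ln (real M)" using assms by simp
  have ln_t: "ln (t / (real M)\<^sup>2) = ln 9 + 3 * ln (real A) - 2 * ln (real M)"
    using assms by (simp add: t_def ln_div ln_mult ln_realpow)
  have pointwise: "- (ln (t / (real M)\<^sup>2) + energy M \<A> / t - 1) / (4 * ln (real M)) \<le> sharp_exponent M \<A>"
    if "\<A> \<in> alphabets M A" for \<A>
  proof -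
    have \<A>: "\<A> \<subseteq> {..<M}" "\<A> \<noteq> {}" "finite \<A>"
      using that assms finite_subset[of \<A> "{0..<M}"] by (auto simp: alphabets_def)
    have pos: "0 < energy M \<A>" by (rule energy_pos[OF \<A>(3,2)])
    have "ln (energy M \<A> / (real M)\<^sup>2) = ln (t / (real M)\<^sup>2) + ln (energy M \<A> / t)"
      using pos t assms by (simp add: ln_div)
    also have "\<dots> \<le> ln (t / (real M)\<^sup>2) + energy M \<A> / t - 1"
      using ln_le_minus_one[of "energy M \<A> / t"] pos t by simp
    finally have "- (ln (t / (real M)\<^sup>2) + energy M \<A> / t - 1) / (4 * ln (real M))
        \<le> - ln (energy M \<A> / (real M)\<^sup>2) / (4 * ln (real M))"
      using lnM by (intro divide_right_mono) auto
    also have "\<dots> \<le> sharp_exponent M \<A>"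
      using assms by (intro sharp_exponent_ge_energy[OF \<A>(1,2)]) simp
    finally show ?thesis .
  qed
  have "(\<Sum>\<A>\<in>alphabets M A. energy M \<A> / t) \<le> C"
    using sum_energy_le[of A M] assms t
    by (simp add: C_def t_def divide_le_eq mult.commute flip: sum_divide_distrib)
  then have "(\<Sum>\<A>\<in>alphabets M A. ln (t / (real M)\<^sup>2) + energy M \<A> / t - 1) \<le> C * ln (t / (real M)\<^sup>2)"
    by (simp add: sum.distrib sum_subtractf card_alphabets C_def)
  then have "C * - ln (t / (real M)\<^sup>2) / (4 * ln (real M))
      \<le> - (\<Sum>\<A>\<in>alphabets M A. ln (t / (real M)\<^sup>2) + energy M \<A> / t - 1) / (4 * ln (real M))"
    using lnM by (intro divide_right_mono) auto
  also have "\<dots> = (\<Sum>\<A>\<in>alphabets M A. - (ln (t / (real M)\<^sup>2) + energy M \<A> / t - 1) / (4 * ln (real M)))"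
    by (simp only: sum_negf[symmetric] sum_divide_distrib)
  also have "\<dots> \<le> (\<Sum>\<A>\<in>alphabets M A. sharp_exponent M \<A>)"
    by (intro sum_mono pointwise)
  finally have "- ln (t / (real M)\<^sup>2) / (4 * ln (real M)) \<le> (\<Sum>\<A>\<in>alphabets M A. sharp_exponent M \<A>) / C"
    using C by (simp add: field_simps)
  moreover have "(\<integral>\<A>. sharp_exponent M \<A> \<partial>uniform_count_measure (alphabets M A)) =
      (\<Sum>\<A>\<in>alphabets M A. sharp_exponent M \<A>) / C"
    by (simp add: integral_uniform_count_measure finite_alphabets card_alphabets C_def)
  moreover have "- ln (t / (real M)\<^sup>2) / (4 * ln (real M)) =
      1 / 2 - 3 / 4 * (ln (real A) / ln (real M)) - ln 9 / (4 * ln (real M))"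
    unfolding ln_t using lnM by (simp add: field_simps)
  ultimately show ?thesis by simp
qed

theorem theorem1p3:
  shows "\<exists>\<eta> :: nat \<Rightarrow> real. \<eta> \<longlonglongrightarrow> 0 \<and>
    (\<forall>(M::nat) (A::nat). M \<ge> 3 \<and> 1 < A \<and> A < M \<longrightarrow>
      (let \<delta> = ln (real A) / ln (real M) in
        (\<integral>\<A>. sharp_exponent M \<A> \<partial>uniform_count_measure (alphabets M A))
          \<ge> max 0 (1 / 2 - 3 / 4 * \<delta> + \<eta> M)))"
proof (intro exI conjI allI impI)
  define \<eta> :: "nat \<Rightarrow> real" where "\<eta> M = - (ln 9 / (4 * ln (real M)))" for M
  have "filterlim (\<lambda>M. ln (real M)) at_top sequentially"
    by (rule filterlim_compose[OF ln_at_top filterlim_real_sequentially])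
  then have "(\<lambda>M. inverse (ln (real M))) \<longlonglongrightarrow> 0"
    by (rule tendsto_inverse_0_at_top)
  then have "(\<lambda>M. - (ln 9 / 4) * inverse (ln (real M))) \<longlonglongrightarrow> - (ln 9 / 4) * 0"
    by (intro tendsto_mult tendsto_const)
  then show "\<eta> \<longlonglongrightarrow> 0" by (simp add: \<eta>_def[abs_def] field_simps)
  fix M A :: nat
  assume asm: "M \<ge> 3 \<and> 1 < A \<and> A < M"
  have "0 \<le> (\<Sum>\<A>\<in>alphabets M A. sharp_exponent M \<A>)"
    using asm by (intro sum_nonneg sharp_exponent_nonneg) (auto simp: alphabets_def)
  then have "0 \<le> (\<integral>\<A>. sharp_exponent M \<A> \<partial>uniform_count_measure (alphabets M A))"
    by (simp add: integral_uniform_count_measure finite_alphabets)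
  then show "let \<delta> = ln (real A) / ln (real M) in
        (\<integral>\<A>. sharp_exponent M \<A> \<partial>uniform_count_measure (alphabets M A))
          \<ge> max 0 (1 / 2 - 3 / 4 * \<delta> + \<eta> M)"
    using expected_sharp_exponent_ge[of M A] asm by (simp add: Let_def \<eta>_def)
qed

end
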